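(* Let $\Delta\neq\mathbb{N}$ be a numerical semigroup and let $d\ge 2$ be an integer. Let $\mathcal{M}_d(\Delta)$ be the set of all numerical semigroups $S$ with $S/d=\Delta$. Then $\mathcal{M}_d(\Delta)$ is exactly the set of numerical semigroups of the form $\langle X\rangle+d\Delta$, where $X\subseteq\Delta$ is finite, $X\cap d\Delta=\varnothing$, $\langle X\rangle\cap d(\mathbb{N}\setminus\Delta)=\varnothing$, and $\gcd(X\cup d\Delta)=1$.
   Context: $\mathbb{N}=\{0,1,2,\dots\}$. A numerical semigroup is a submonoid of $(\mathbb{N},+)$ with finite complement in $\mathbb{N}$. For $A\subseteq\mathbb{N}$ and $d\ge1$, $A/d=\{x\in\mathbb{N}: dx\in A\}$ and $dA=\{dx: x\in A\}$. For subsets $A,B\subseteq\mathbb{N}$, $A+B=\{a+b: a\in A, b\in B\}$. $\langle X\rangle$ denotes the submonoid of $(\mathbb{N},+)$ generated by $X$ (so $\langle\varnothing\rangle=\{0\}$). *)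

theory Defs
  imports Complex_Main "HOL-Library.Set_Algebras"
begin

definition add_submonoid :: "nat set \<Rightarrow> bool" where
  "add_submonoid S \<longleftrightarrow> 0 \<in> S \<and> (\<forall>x\<in>S. \<forall>y\<in>S. x + y \<in> S)"

definition numerical_semigroup :: "nat set \<Rightarrow> bool" where
  "numerical_semigroup S \<longleftrightarrow> add_submonoid S \<and> finite (UNIV - S)"

definition gen_submonoid :: "nat set \<Rightarrow> nat set" where
  "gen_submonoid X = add_submonoid hull X"

definition set_quotient :: "nat set \<Rightarrow> nat \<Rightarrow> nat set" where
  "set_quotient A d = {x. d * x \<in> A}"

definition dilate :: "nat \<Rightarrow> nat set \<Rightarrow> nat set" where
  "dilate d A = {d * x | x. x \<in> A}"

definition semigroup_multiples :: "nat \<Rightarrow> nat set \<Rightarrow> nat set set" where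
  "semigroup_multiples d \<Delta> = {S. numerical_semigroup S \<and> set_quotient S d = \<Delta>}"

lemma add_submonoid_gen_submonoid: "add_submonoid (gen_submonoid X)"
  unfolding gen_submonoid_def by (rule hull_in) (auto simp: add_submonoid_def)

lemma gen_submonoid_empty: "gen_submonoid {} = {0}"
proof
  have "add_submonoid {0}" by (simp add: add_submonoid_def)
  then show "gen_submonoid {} \<subseteq> {0}"
    unfolding gen_submonoid_def by (intro hull_minimal) auto
  show "{0} \<subseteq> gen_submonoid {}"
    using add_submonoid_gen_submonoid[of "{}"] by (simp add: add_submonoid_def)
qed

end

(*
  If S/d = \<Delta> then dS \<subseteq> S forces S \<subseteq> \<Delta>, and S is generated by finitely many small elements;
  those lying in d\<Delta> can be replaced by all of d\<Delta>, so S = \<langle>X\<rangle> + d\<Delta> with X the remaining ones.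
  Conversely, if a + d\<delta> = dy with a \<in> \<langle>X\<rangle>, then a = d(y - \<delta>), so y - \<delta> \<in> \<Delta> because \<langle>X\<rangle>
  avoids d(\<nat> - \<Delta>); hence the quotient is \<Delta>, and cofiniteness is the gcd condition.
*)
theory Submission
  imports Defs
begin

lemma add_submonoid_mult:
  assumes "add_submonoid S" "x \<in> S"
  shows "k * x \<in> S"
  using assms by (induction k) (auto simp: add_submonoid_def)

lemma add_submonoid_set_plus:
  assumes "add_submonoid A" "add_submonoid B"
  shows "add_submonoid (A + B)"
  unfolding add_submonoid_def
proof (intro conjI ballI)
  show "0 \<in> A + B"
    using assms set_plus_intro[of 0 A 0 B] by (simp add: add_submonoid_def)
next
  fix x y assume "x \<in> A + B" "y \<in> A + B"
  then obtain a b a' b' where ab: "x = a + b" "y = a' + b'" "a \<in> A" "a' \<in> A" "b \<in> B" "b' \<in> B"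
    by (auto elim!: set_plus_elim)
  then have "(a + a') + (b + b') \<in> A + B"
    using assms by (intro set_plus_intro) (auto simp: add_submonoid_def)
  then show "x + y \<in> A + B"
    using ab by (simp add: ac_simps)
qed

lemma add_submonoid_dilate:
  assumes "add_submonoid S"
  shows "add_submonoid (dilate d S)"
proof -
  have "d * x + d * y \<in> dilate d S" if "x \<in> S" "y \<in> S" for x y
    using assms that unfolding dilate_def add_submonoid_def
    by (auto intro!: exI[of _ "x + y"] simp: distrib_left)
  moreover have "0 \<in> dilate d S"
    using assms by (auto simp: dilate_def add_submonoid_def)
  ultimately show ?thesis
    unfolding add_submonoid_def by (auto simp: dilate_def)
qed

lemma gen_submonoid_superset: "X \<subseteq> gen_submonoid X"
  unfolding gen_submonoid_def by (rule hull_subset)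

lemma gen_submonoid_minimal:
  assumes "X \<subseteq> S" "add_submonoid S"
  shows "gen_submonoid X \<subseteq> S"
  using assms unfolding gen_submonoid_def by (rule hull_minimal)

text \<open>The least positive difference of two elements of \<open>S\<close> divides every element of \<open>S\<close>.\<close>

lemma Gcd_eq_1_imp_consecutive:
  assumes S: "add_submonoid S" and "Gcd S = 1"
  obtains a where "a \<in> S" "Suc a \<in> S"
proof -
  define P where "P k \<longleftrightarrow> 0 < k \<and> (\<exists>a\<in>S. a + k \<in> S)" for k
  have "\<not> S \<subseteq> {0}"
    using \<open>Gcd S = 1\<close> by (metis Gcd_0_iff zero_neq_one)
  then obtain s where "s \<in> S" "s > 0" by auto
  \<comment> \<open>The difference \<open>s\<close> is realized from the base element
    \<open>0\<close>, so a least positive difference exists.\<close>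
  then have "P s"
    using S by (auto simp: P_def add_submonoid_def)
  define g where "g = (LEAST k. P k)"
  have "P g" unfolding g_def by (rule LeastI) fact
  then obtain a where a: "a \<in> S" "a + g \<in> S" and "g > 0" by (auto simp: P_def)
  have "g dvd t" if "t \<in> S" for t
  proof (rule ccontr)
    assume "\<not> g dvd t"
    define q r where "q = t div g" and "r = t mod g"
    have t: "t = q * g + r" by (simp add: q_def r_def)
    have "0 < r" "r < g"
      using \<open>\<not> g dvd t\<close> \<open>g > 0\<close> by (auto simp: r_def dvd_eq_mod_eq_0)
    \<comment> \<open>These two elements of \<open>S\<close> differ by exactly \<open>r\<close>, a
      positive difference smaller than the least one \<open>g\<close>.\<close>
    have "q * (a + g) \<in> S" "q * a + t \<in> S"
      using a that S add_submonoid_mult[OF S] by (auto simp: add_submonoid_def)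
    moreover have "q * a + t = q * (a + g) + r"
      by (simp add: t distrib_left)
    ultimately have "P r" using \<open>0 < r\<close> by (auto simp: P_def)
    then show False
      using \<open>r < g\<close> not_less_Least unfolding g_def by blast
  qed
  then have "g dvd Gcd S" by (rule Gcd_greatest)
  then have "g = 1" using \<open>Gcd S = 1\<close> by simp
  then show thesis using a that by simp
qed

text \<open>Consecutive elements \<open>b\<close> and \<open>Suc b\<close> of \<open>S\<close> reach
  every \<open>n\<close> from \<open>b * b\<close> on: if \<open>n = q * b + r\<close> with
  \<open>r < b\<close>, then \<open>b \<le> q\<close>, so \<open>r\<close> of the \<open>q\<close>
  copies of \<open>b\<close> can be traded for \<open>Suc b\<close>, which absorbs the
  remainder.\<close>

lemma numerical_semigroup_Gcd:
  assumes S: "add_submonoid S" and "Gcd S = 1"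
  shows "numerical_semigroup S"
proof -
  obtain a where "a \<in> S" "Suc a \<in> S"
    using Gcd_eq_1_imp_consecutive[OF assms] .
  \<comment> \<open>The case \<open>a = 0\<close> must be avoided because we divide by \<open>a\<close>.\<close>
  then obtain b where b: "b \<in> S" "Suc b \<in> S" "b > 0"
    using S add_submonoid_mult[OF S, of 1 2]
    by (cases "a = 0") (auto simp: numeral_2_eq_2)
  have "n \<in> S" if "b * b \<le> n" for n
  proof -
    define q r where "q = n div b" and "r = n mod b"
    have "r < b" "b \<le> q"
      using b div_le_mono[OF that, of b] by (simp_all add: q_def r_def)
    then have "r \<le> q" by simp
    have "n = q * b + r" by (simp add: q_def r_def)
    also have "\<dots> = (q - r) * b + r * Suc b"
      using \<open>r \<le> q\<close> by (simp add: diff_mult_distrib mult_le_mono1)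
    also have "\<dots> \<in> S"
      using S b add_submonoid_mult[OF S] by (auto simp: add_submonoid_def simp del: mult_Suc_right)
    finally show ?thesis .
  qed
  then have "UNIV - S \<subseteq> {..<b * b}" by (auto simp: not_le[symmetric])
  then show ?thesis
    using S finite_subset by (auto simp: numerical_semigroup_def)
qed

lemma numerical_semigroup_bound:
  assumes "numerical_semigroup S"
  obtains c where "\<And>n. c \<le> n \<Longrightarrow> n \<in> S"
proof -
  obtain c where "\<forall>n\<in>UNIV - S. n < c"
    using assms unfolding numerical_semigroup_def finite_nat_set_iff_bounded by blast
  then show thesis using that[of c] by (meson DiffI UNIV_I not_le)
qed

lemma Gcd_numerical_semigroup:
  assumes "numerical_semigroup S"
  shows "Gcd S = 1"
proof -
  obtain c where "\<And>n. c \<le> n \<Longrightarrow> n \<in> S"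
    using numerical_semigroup_bound[OF assms] by blast
  then have "Gcd S dvd c" "Gcd S dvd Suc c"
    by (simp_all add: Gcd_dvd)
  then have "Gcd S dvd Suc c - c" by (intro dvd_diff_nat)
  then show ?thesis by simp
qed

text \<open>Once all \<open>n \<ge> c\<close> lie in \<open>S\<close>, any element above
  \<open>2 * c + 1\<close> splits into two strictly smaller elements of \<open>S\<close>, so strong
  induction descends to the finitely many elements up to that bound.\<close>

lemma numerical_semigroup_finitely_generated:
  assumes "numerical_semigroup S"
  obtains F where "finite F" "gen_submonoid F = S"
proof -
  have S: "add_submonoid S" using assms by (simp add: numerical_semigroup_def)
  obtain c where c: "\<And>n. c \<le> n \<Longrightarrow> n \<in> S"
    using numerical_semigroup_bound[OF assms] by blast
  define F where "F = S \<inter> {..2 * c + 1}"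
  have "s \<in> gen_submonoid F" if "s \<in> S" for s
    using that
  proof (induction s rule: less_induct)
    case (less s)
    show ?case
    proof (cases "s \<le> 2 * c + 1")
      case True
      with less.prems show ?thesis
        using gen_submonoid_superset[of F] by (auto simp: F_def)
    next
      case False
      \<comment> \<open>Taking \<open>c + 1\<close> rather than \<open>c\<close> keeps the first
        summand positive even for \<open>c = 0\<close>, so the second is strictly smaller than
        \<open>s\<close>.\<close>
      have "c + 1 \<in> gen_submonoid F" "s - (c + 1) \<in> gen_submonoid F"
        using False c by (auto intro!: less.IH)
      then have "(c + 1) + (s - (c + 1)) \<in> gen_submonoid F"
        using add_submonoid_gen_submonoid[of F] unfolding add_submonoid_def by blast
      then show ?thesis using False by simp
    qed
  qed
  moreover have "gen_submonoid F \<subseteq> S"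
    by (rule gen_submonoid_minimal) (auto simp: F_def S)
  ultimately show thesis
    using that[of F] by (auto simp: F_def)
qed

lemma dilate_set_quotient_subset: "dilate d (set_quotient S d) \<subseteq> S"
  by (auto simp: dilate_def set_quotient_def)

lemma subset_set_quotient:
  assumes "add_submonoid S"
  shows "S \<subseteq> set_quotient S d"
  using add_submonoid_mult[OF assms] by (auto simp: set_quotient_def)

lemma set_quotient_gen_plus_dilate:
  assumes "add_submonoid \<Delta>" "d > 0"
    and "gen_submonoid X \<inter> dilate d (UNIV - \<Delta>) = {}"
  shows "set_quotient (gen_submonoid X + dilate d \<Delta>) d = \<Delta>"
proof (intro equalityI subsetI)
  fix y assume "y \<in> set_quotient (gen_submonoid X + dilate d \<Delta>) d"
  then obtain a \<delta> where a: "a \<in> gen_submonoid X" "\<delta> \<in> \<Delta>" "d * y = a + d * \<delta>"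
    by (auto simp: set_quotient_def dilate_def elim!: set_plus_elim)
  \<comment> \<open>This makes \<open>y - \<delta>\<close> a genuine difference rather than a
    truncated one.\<close>
  then have "\<delta> \<le> y" using \<open>d > 0\<close> by (metis le_add2 nat_mult_le_cancel1)
  have "a = d * (y - \<delta>)" using a by (simp add: diff_mult_distrib2)
  then have "y - \<delta> \<in> \<Delta>" using a assms(3) by (auto simp: dilate_def)
  then have "(y - \<delta>) + \<delta> \<in> \<Delta>"
    using assms(1) a by (auto simp: add_submonoid_def simp del: le_add_diff_inverse2)
  then show "y \<in> \<Delta>" using \<open>\<delta> \<le> y\<close> by simp
next
  fix y assume "y \<in> \<Delta>"
  then have "0 + d * y \<in> gen_submonoid X + dilate d \<Delta>"
    using add_submonoid_gen_submonoid[of X]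
    by (intro set_plus_intro) (auto simp: dilate_def add_submonoid_def)
  then show "y \<in> set_quotient (gen_submonoid X + dilate d \<Delta>) d"
    by (simp add: set_quotient_def)
qed

text \<open>Both summands contain \<open>0\<close>, so the sum is a submonoid containing
  \<open>X\<close> and \<open>B\<close>. With \<open>B = dilate d \<Delta>\<close>, this turns the
  form in the theorem into a submonoid with explicit generators.\<close>

lemma gen_submonoid_Un:
  assumes "add_submonoid B"
  shows "gen_submonoid (X \<union> B) = gen_submonoid X + B"
proof
  have "x \<in> gen_submonoid X + B" if "x \<in> X" for x
    using that assms gen_submonoid_superset[of X] set_plus_intro[of x "gen_submonoid X" 0 B]
    by (auto simp: add_submonoid_def)
  moreover have "b \<in> gen_submonoid X + B" if "b \<in> B" for b
    using that add_submonoid_gen_submonoid[of X] set_plus_intro[of 0 "gen_submonoid X" b B]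
    by (auto simp: add_submonoid_def)
  ultimately show "gen_submonoid (X \<union> B) \<subseteq> gen_submonoid X + B"
    by (intro gen_submonoid_minimal add_submonoid_set_plus add_submonoid_gen_submonoid assms) auto
next
  have "gen_submonoid X \<subseteq> gen_submonoid (X \<union> B)"
    using gen_submonoid_superset[of "X \<union> B"]
    by (intro gen_submonoid_minimal add_submonoid_gen_submonoid) auto
  then show "gen_submonoid X + B \<subseteq> gen_submonoid (X \<union> B)"
    using add_submonoid_gen_submonoid[of "X \<union> B"] gen_submonoid_superset[of "X \<union> B"]
    by (force simp: add_submonoid_def elim!: set_plus_elim)
qed

text \<open>The multiples of \<open>Gcd X\<close> form a submonoid containing \<open>X\<close>, so
  passing to generated elements loses no common divisor.\<close>

lemma Gcd_gen_submonoid: "Gcd (gen_submonoid X) = Gcd X"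
proof (rule dvd_antisym)
  show "Gcd (gen_submonoid X) dvd Gcd X"
    using gen_submonoid_superset[of X] by (intro Gcd_greatest Gcd_dvd) auto
  have "gen_submonoid X \<subseteq> {n. Gcd X dvd n}"
    by (rule gen_submonoid_minimal) (auto simp: add_submonoid_def Gcd_dvd)
  then show "Gcd X dvd Gcd (gen_submonoid X)"
    by (auto intro!: Gcd_greatest)
qed

theorem theorem2p11:
  fixes \<Delta> :: "nat set" and d :: nat
  assumes "numerical_semigroup \<Delta>" and "\<Delta> \<noteq> UNIV" and "d \<ge> 2"
  shows "semigroup_multiples d \<Delta> =
    {gen_submonoid X + dilate d \<Delta> | X.
       finite X \<and> X \<subseteq> \<Delta> \<and> X \<inter> dilate d \<Delta> = {}
       \<and> gen_submonoid X \<inter> dilate d (UNIV - \<Delta>) = {}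
       \<and> Gcd (X \<union> dilate d \<Delta>) = 1}"
    (is "_ = ?R")
proof (intro equalityI subsetI)
  have \<Delta>: "add_submonoid \<Delta>" and d\<Delta>: "add_submonoid (dilate d \<Delta>)"
    using assms(1) add_submonoid_dilate by (auto simp: numerical_semigroup_def)
  {
    fix S assume "S \<in> semigroup_multiples d \<Delta>"
    then have S: "numerical_semigroup S" "add_submonoid S" and quot: "set_quotient S d = \<Delta>"
      by (auto simp: semigroup_multiples_def numerical_semigroup_def)
    obtain F where F: "finite F" "gen_submonoid F = S"
      using numerical_semigroup_finitely_generated[OF S(1)] .
    define X where "X = F - dilate d \<Delta>"
    have "X \<subseteq> S" "dilate d \<Delta> \<subseteq> S"
      using F gen_submonoid_superset dilate_set_quotient_subset[of d S] quot by (auto simp: X_def)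
    \<comment> \<open>Each generator in \<open>F\<close> either survives in \<open>X\<close> or was
      removed for lying in \<open>dilate d \<Delta>\<close>.\<close>
    have "S \<subseteq> gen_submonoid (X \<union> dilate d \<Delta>)"
      unfolding F(2)[symmetric] using gen_submonoid_superset[of "X \<union> dilate d \<Delta>"]
      by (intro gen_submonoid_minimal add_submonoid_gen_submonoid) (auto simp: X_def)
    then have gen: "S = gen_submonoid (X \<union> dilate d \<Delta>)"
      using gen_submonoid_minimal[of "X \<union> dilate d \<Delta>" S] \<open>X \<subseteq> S\<close> \<open>dilate d \<Delta> \<subseteq> S\<close> S(2) by blast
    have "S = gen_submonoid X + dilate d \<Delta>"
      using gen gen_submonoid_Un[OF d\<Delta>] by simp
    moreover have "finite X" "X \<inter> dilate d \<Delta> = {}"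
      using F by (auto simp: X_def)
    moreover have "X \<subseteq> \<Delta>"
      using \<open>X \<subseteq> S\<close> subset_set_quotient[OF S(2)] quot by blast
    \<comment> \<open>An element \<open>d * x\<close> of \<open>gen_submonoid X\<close> lies in
      \<open>S\<close>, which puts \<open>x\<close> in the quotient \<open>\<Delta>\<close>.\<close>
    moreover have "gen_submonoid X \<inter> dilate d (UNIV - \<Delta>) = {}"
      using gen_submonoid_minimal[OF \<open>X \<subseteq> S\<close> S(2)] quot
      by (auto simp: dilate_def set_quotient_def)
    moreover have "Gcd (X \<union> dilate d \<Delta>) = 1"
      using Gcd_numerical_semigroup[OF S(1)] Gcd_gen_submonoid gen by metis
    ultimately show "S \<in> ?R" by blast
  next
    fix S assume "S \<in> ?R"
    then obtain X where S: "S = gen_submonoid X + dilate d \<Delta>"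
      and disj: "gen_submonoid X \<inter> dilate d (UNIV - \<Delta>) = {}"
      and gcd: "Gcd (X \<union> dilate d \<Delta>) = 1"
      by blast
    have "S = gen_submonoid (X \<union> dilate d \<Delta>)"
      using S gen_submonoid_Un[OF d\<Delta>] by simp
    \<comment> \<open>The gcd of the generators is that of \<open>S\<close>, and a submonoid of gcd
      1 is cofinite.\<close>
    then have "numerical_semigroup S"
      using gcd by (metis numerical_semigroup_Gcd add_submonoid_gen_submonoid Gcd_gen_submonoid)
    moreover have "set_quotient S d = \<Delta>"
      unfolding S using \<Delta> assms(3) disj by (intro set_quotient_gen_plus_dilate) auto
    ultimately show "S \<in> semigroup_multiples d \<Delta>"
      by (simp add: semigroup_multiples_def)
  }
qed

end
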